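(* Let $N\ge 2$, let $\gamma\ge 2$ be a real number, and let $\mathcal{E}$ be a bipartite quantum measure satisfying the generalized $\gamma$th-monogamy relation $$\mathcal{E}^{\gamma}(\rho_{A|B_1B_2\cdots B_{N-1}})\ \ge\ \sum_{i=1}^{N-1}\mathcal{E}^{\gamma}(\rho_{AB_i})$$ for $N$-qubit states. Let $\rho_{AB_1\cdots B_{N-1}}$ be any $N$-qubit state, and let $\mathcal{E}_1\ge\mathcal{E}_2\ge\cdots\ge\mathcal{E}_{N-1}$ be the numbers $\mathcal{E}_{AB_1},\dots,\mathcal{E}_{AB_{N-1}}$ arranged in descending order. If $a\ge 1$ is a real number such that $\mathcal{E}_i^{\gamma}\ge a\,\mathcal{E}_{i+1}^{\gamma}$ for $i=1,\dots,N-2$, then for all real $\alpha$ with $0\le\alpha\le\gamma$ and all real $s>0$, $$\mathcal{E}_{A|B_1\cdots B_{N-1}}^{\alpha}\ \ge\ \left(1+\frac{a}{s}\right)^{\frac{\alpha}{\gamma}-1}\sum_{i=1}^{N-1}\left(\left(1+\frac{s}{a}\right)^{\frac{\alpha}{\gamma}-1}\right)^{N-1-i}\mathcal{E}_i^{\alpha}.$$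
   Context: A state on a Hilbert space is a density matrix (positive semidefinite operator of trace $1$). A bipartite quantum measure (bipartite entanglement measure of quantum correlation) $\mathcal{E}$ assigns a nonnegative real number to each bipartite state. For an $N$-partite state $\rho=\rho_{AB_1\cdots B_{N-1}}$ on $\mathcal{H}_A\otimes\mathcal{H}_{B_1}\otimes\cdots\otimes\mathcal{H}_{B_{N-1}}$ (each factor $\mathbb{C}^2$ in the $N$-qubit case), $\rho_{AB_i}$ denotes the reduced density matrix obtained by tracing out all $B_j$ with $j\ne i$, and $\rho_{A|B_1\cdots B_{N-1}}$ denotes $\rho$ viewed as a bipartite state on $\mathcal{H}_A\otimes(\mathcal{H}_{B_1}\otimes\cdots\otimes\mathcal{H}_{B_{N-1}})$. Notation: $\mathcal{E}_{AB_i}=\mathcal{E}(\rho_{AB_i})$ and $\mathcal{E}_{A|B_1\cdots B_{N-1}}=\mathcal{E}(\rho_{A|B_1\cdots B_{N-1}})$. Superscripts on $\mathcal{E}$ are powers, with the convention $0^0=1$. *)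

theory Defs
  imports "Jordan_Normal_Form.Matrix" Complex_Main
begin

(* The order on complex numbers is that of HOL-Library.Complex_Order: "0 \<le> z" says that z is
   real and nonnegative. Over the complex numbers this makes a psd matrix Hermitian. *)
definition psd :: "nat \<Rightarrow> complex mat \<Rightarrow> bool" where
  "psd d A \<longleftrightarrow> A \<in> carrier_mat d d \<and> (\<forall>v \<in> carrier_vec d. 0 \<le> (A *\<^sub>v v) \<bullet>c v)"

definition mat_tr :: "complex mat \<Rightarrow> complex" where
  "mat_tr A = (\<Sum>i<dim_row A. A $$ (i, i))"

definition density_matrix :: "nat \<Rightarrow> complex mat \<Rightarrow> bool" where
  "density_matrix d \<rho> \<longleftrightarrow> psd d \<rho> \<and> mat_tr \<rho> = 1"

(* The value of qubit k (counted from 0) in the computational basis vector number x of n qubits.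
   Basis vectors are numbered in the Kronecker order, the first factor being the most significant,
   so that \<bar>u\<rangle> \<otimes> \<bar>v\<rangle> in C^m \<otimes> C^n has number u * n + v. *)
definition qubit :: "nat \<Rightarrow> nat \<Rightarrow> nat \<Rightarrow> nat" where
  "qubit n k x = (x div 2 ^ (n - 1 - k)) mod 2"

(* The reduced density matrix of an n-qubit state on the qubits listed in ks, in that order
   (ks distinct with entries below n): all qubits not in ks are traced out. The entry (i, j) is
   the sum of \<rho> over the pairs (x, y) that restrict to i and j on the qubits ks and
   agree on all other qubits. *)
definition reduced_state :: "nat \<Rightarrow> nat list \<Rightarrow> complex mat \<Rightarrow> complex mat" where
  "reduced_state n ks \<rho> = mat (2 ^ length ks) (2 ^ length ks) (\<lambda>(i, j).
     \<Sum>(x, y) \<in> {(x, y). x < 2 ^ n \<and> y < 2 ^ n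
       \<and> (\<forall>l < length ks. qubit n (ks ! l) x = qubit (length ks) l i)
       \<and> (\<forall>l < length ks. qubit n (ks ! l) y = qubit (length ks) l j)
       \<and> (\<forall>k < n. k \<notin> set ks \<longrightarrow> qubit n k x = qubit n k y)}. \<rho> $$ (x, y))"

(* Real powers of a nonnegative base with the convention 0^0 = 1 (whereas 0 powr 0 = 0). *)
definition rpow :: "real \<Rightarrow> real \<Rightarrow> real" where
  "rpow x p = (if p = 0 then 1 else x powr p)"

(* E m n \<rho> is the value of the measure at a state \<rho> of C^m \<otimes> C^n; only its
   values at states matter. *)
definition bipartite_measure :: "(nat \<Rightarrow> nat \<Rightarrow> complex mat \<Rightarrow> real) \<Rightarrow> bool" where
  "bipartite_measure E \<longleftrightarrow> (\<forall>m n \<rho>. density_matrix (m * n) \<rho> \<longrightarrow> 0 \<le> E m n \<rho>)"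

(* Party A is qubit 0 and B_i is qubit i. *)
definition E_AB :: "(nat \<Rightarrow> nat \<Rightarrow> complex mat \<Rightarrow> real) \<Rightarrow> nat \<Rightarrow> complex mat \<Rightarrow> nat \<Rightarrow> real" where
  "E_AB E N \<rho> i = E 2 2 (reduced_state N [0, i] \<rho>)"

definition E_A_rest :: "(nat \<Rightarrow> nat \<Rightarrow> complex mat \<Rightarrow> real) \<Rightarrow> nat \<Rightarrow> complex mat \<Rightarrow> real" where
  "E_A_rest E N \<rho> = E 2 (2 ^ (N - 1)) \<rho>"

definition monogamy_relation ::
  "(nat \<Rightarrow> nat \<Rightarrow> complex mat \<Rightarrow> real) \<Rightarrow> nat \<Rightarrow> real \<Rightarrow> bool" where
  "monogamy_relation E N \<gamma> \<longleftrightarrow> (\<forall>\<rho>. density_matrix (2 ^ N) \<rho> \<longrightarrow>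
     rpow (E_A_rest E N \<rho>) \<gamma> \<ge> (\<Sum>i = 1..N - 1. rpow (E_AB E N \<rho> i) \<gamma>))"

end

theory Submission
  imports Defs "HOL-Analysis.Convex"
begin

text \<open>
  With x = \<alpha> / \<gamma> in [0, 1], p = (1 + a / s) powr (x - 1) and q = (1 + s / a) powr (x - 1),
  the numbers \<mu> = s / (a + s) and \<nu> = a / (a + s) are weights of sum 1 such that p = \<mu> powr (1 - x)
  and q = \<nu> powr (1 - x). Concavity of the x-th power (in the form of Young's inequality) gives
  (u + v)^x \<ge> p u^x + q v^x for all nonnegative u, v. Peeling off the last
  summand repeatedly bounds (\<Sum> t i)^x below, where t i = (e i)^\<gamma>, and the monogamy relation
  concludes.
\<close>

lemma rpow_nonneg [simp]: "0 \<le> rpow x p"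
  by (simp add: rpow_def)

lemma rpow_mono:
  assumes "0 \<le> x" "x \<le> y" "0 \<le> p"
  shows "rpow x p \<le> rpow y p"
  using assms by (simp add: rpow_def powr_mono2)

lemma rpow_rpow:
  assumes "p \<noteq> 0"
  shows "rpow (rpow x p) q = rpow x (p * q)"
  using assms by (simp add: rpow_def powr_powr)

text \<open>Weighted concavity of the \<open>x\<close>-th power: write \<open>u + v\<close> as the
  mean of \<open>u / \<mu>\<close> and \<open>v / \<nu>\<close> with weights \<open>\<mu>\<close>
  and \<open>\<nu>\<close>; then
  \<open>\<mu> * (u / \<mu>) powr x = \<mu> powr (1 - x) * u powr x\<close>, and likewise for
  \<open>v\<close>.\<close>

lemma rpow_add_ge:
  fixes u v x \<mu> \<nu> :: real
  assumes "0 \<le> u" "0 \<le> v" and x: "0 \<le> x" "x \<le> 1"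
    and \<mu>: "0 < \<mu>" and \<nu>: "0 < \<nu>" and sum: "\<mu> + \<nu> = 1"
  shows "\<mu> powr (1 - x) * rpow u x + \<nu> powr (1 - x) * rpow v x \<le> rpow (u + v) x"
\<comment> \<open>For \<open>x = 0\<close> every \<open>rpow\<close> is 1 and the claim reads
  \<open>\<mu> + \<nu> \<le> 1\<close>. Otherwise \<open>u + v\<close> has to be positive, as it
  becomes a divisor.\<close>
proof (cases "x = 0 \<or> u + v = 0")
  case True
  then show ?thesis
    using assms by (auto simp: rpow_def add_nonneg_eq_0_iff)
next
  case False
  define S where "S = u + v"
  have S: "0 < S"
    using False assms by (simp add: S_def)
  \<comment> \<open>Dividing by \<open>S\<close> makes the two bounds, for \<open>\<mu>\<close> with
    \<open>u\<close> and \<open>\<nu>\<close> with \<open>v\<close>, add up to exactly 1. At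
    \<open>r = 0\<close> the left side vanishes.\<close>
  have young: "w powr (1 - x) * (r / S) powr x \<le> (1 - x) * w + x * (r / S)"
    if "0 < w" "0 \<le> r" for w r
    using Youngs_inequality_0[of "1 - x" x w "r / S"] that x S by (cases "r = 0") auto
  have "\<mu> powr (1 - x) * (u / S) powr x + \<nu> powr (1 - x) * (v / S) powr x
      \<le> (1 - x) * (\<mu> + \<nu>) + x * ((u + v) / S)"
    using young[OF \<mu> \<open>0 \<le> u\<close>] young[OF \<nu> \<open>0 \<le> v\<close>]
    by (simp add: algebra_simps add_divide_distrib)
  also have "\<dots> = 1"
    using sum S by (simp add: S_def)
  finally have "(\<mu> powr (1 - x) * u powr x + \<nu> powr (1 - x) * v powr x) / S powr x \<le> 1"
    using assms S by (simp add: powr_divide add_divide_distrib)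
  then show ?thesis
    using False S by (simp add: rpow_def S_def)
qed

text \<open>Each appended summand enters with \<open>\<mu> powr (1 - x)\<close> and multiplies the
  bound for the earlier ones by \<open>\<nu> powr (1 - x)\<close>, so the \<open>i\<close>-th term
  collects \<open>n - i\<close> such factors.\<close>

lemma rpow_sum_ge:
  fixes t :: "nat \<Rightarrow> real" and x \<mu> \<nu> :: real
  assumes "1 \<le> n" and t: "\<And>i. 0 \<le> t i" and x: "0 \<le> x" "x \<le> 1"
    and w: "0 < \<mu>" "0 < \<nu>" "\<mu> + \<nu> = 1"
  shows "\<mu> powr (1 - x) * (\<Sum>i = 1..n. (\<nu> powr (1 - x)) ^ (n - i) * rpow (t i) x)
    \<le> rpow (\<Sum>i = 1..n. t i) x"
  using \<open>1 \<le> n\<close>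
proof (induction n rule: dec_induct)
  case base
  \<comment> \<open>A single summand has exponent 0, so only the prefactor must be bounded.\<close>
  have "\<mu> powr (1 - x) \<le> 1"
    using powr_mono2[of "1 - x" \<mu> 1] x w by simp
  then show ?case
    by (simp add: mult_left_le_one_le)
next
  case (step n)
  let ?p = "\<mu> powr (1 - x)" and ?q = "\<nu> powr (1 - x)"
  have "(\<Sum>i = 1..n. ?q ^ (Suc n - i) * rpow (t i) x)
      = ?q * (\<Sum>i = 1..n. ?q ^ (n - i) * rpow (t i) x)"
    unfolding sum_distrib_left by (intro sum.cong) (auto simp: Suc_diff_le)
  then have "?p * (\<Sum>i = 1..Suc n. ?q ^ (Suc n - i) * rpow (t i) x)
      = ?p * rpow (t (Suc n)) x + ?q * (?p * (\<Sum>i = 1..n. ?q ^ (n - i) * rpow (t i) x))"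
    by (simp add: algebra_simps)
  also have "\<dots> \<le> ?p * rpow (t (Suc n)) x + ?q * rpow (\<Sum>i = 1..n. t i) x"
    using step.IH by (intro add_left_mono mult_left_mono) auto
  also have "\<dots> \<le> rpow (t (Suc n) + (\<Sum>i = 1..n. t i)) x"
    using rpow_add_ge t x w by (simp add: sum_nonneg)
  finally show ?case
    by (simp add: add.commute)
qed

theorem theorem2p4:
  fixes N :: nat and \<gamma> a \<alpha> s :: real
    and E :: "nat \<Rightarrow> nat \<Rightarrow> complex mat \<Rightarrow> real"
    and \<rho> :: "complex mat" and e :: "nat \<Rightarrow> real" and \<pi> :: "nat \<Rightarrow> nat"
  assumes "N \<ge> 2" and "\<gamma> \<ge> 2"
    and "bipartite_measure E"
    and "monogamy_relation E N \<gamma>"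
    and "density_matrix (2 ^ N) \<rho>"
    and arrangement: "bij_betw \<pi> {1..N - 1} {1..N - 1}"
      "\<And>i. i \<in> {1..N - 1} \<Longrightarrow> e i = E_AB E N \<rho> (\<pi> i)"
    and descending: "\<And>i. i \<in> {1..N - 2} \<Longrightarrow> e i \<ge> e (i + 1)"
    and "a \<ge> 1"
    and "\<And>i. i \<in> {1..N - 2} \<Longrightarrow> rpow (e i) \<gamma> \<ge> a * rpow (e (i + 1)) \<gamma>"
    and "0 \<le> \<alpha>" and "\<alpha> \<le> \<gamma>" and "s > 0"
  shows "rpow (E_A_rest E N \<rho>) \<alpha> \<ge>
    (1 + a / s) powr (\<alpha> / \<gamma> - 1) *
      (\<Sum>i = 1..N - 1. ((1 + s / a) powr (\<alpha> / \<gamma> - 1)) ^ (N - 1 - i) * rpow (e i) \<alpha>)"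
proof -
  define x \<mu> \<nu> where "x = \<alpha> / \<gamma>" and "\<mu> = s / (a + s)" and "\<nu> = a / (a + s)"
  have x: "0 \<le> x" "x \<le> 1"
    using assms by (simp_all add: x_def)
  have w: "0 < \<mu>" "0 < \<nu>" "\<mu> + \<nu> = 1"
    using \<open>a \<ge> 1\<close> \<open>s > 0\<close> by (simp_all add: \<mu>_def \<nu>_def flip: add_divide_distrib)
  have "1 + a / s = inverse \<mu>" "1 + s / a = inverse \<nu>"
    using \<open>a \<ge> 1\<close> \<open>s > 0\<close> by (simp_all add: \<mu>_def \<nu>_def field_simps)
  \<comment> \<open>Passing to the reciprocal base flips the sign of the exponent.\<close>
  then have p: "(1 + a / s) powr (x - 1) = \<mu> powr (1 - x)"
    and q: "(1 + s / a) powr (x - 1) = \<nu> powr (1 - x)"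
    using powr_minus[of \<mu> "x - 1"] powr_minus[of \<nu> "x - 1"] w by (simp_all add: inverse_powr)
  have pow: "rpow (rpow y \<gamma>) x = rpow y \<alpha>" for y
    using \<open>\<gamma> \<ge> 2\<close> by (simp add: rpow_rpow x_def)
  \<comment> \<open>The sum in the monogamy relation does not depend on the order, so it may be
    taken over the rearranged values.\<close>
  have "(\<Sum>i = 1..N - 1. rpow (e i) \<gamma>) = (\<Sum>i = 1..N - 1. rpow (E_AB E N \<rho> (\<pi> i)) \<gamma>)"
    using arrangement(2) by (intro sum.cong) auto
  also have "\<dots> = (\<Sum>i = 1..N - 1. rpow (E_AB E N \<rho> i) \<gamma>)"
    using arrangement(1) by (rule sum.reindex_bij_betw)
  also have "\<dots> \<le> rpow (E_A_rest E N \<rho>) \<gamma>"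
    using assms by (simp add: monogamy_relation_def)
  finally have "rpow (\<Sum>i = 1..N - 1. rpow (e i) \<gamma>) x \<le> rpow (rpow (E_A_rest E N \<rho>) \<gamma>) x"
    using x by (intro rpow_mono sum_nonneg) auto
  moreover have "\<mu> powr (1 - x) *
      (\<Sum>i = 1..N - 1. (\<nu> powr (1 - x)) ^ (N - 1 - i) * rpow (rpow (e i) \<gamma>) x)
      \<le> rpow (\<Sum>i = 1..N - 1. rpow (e i) \<gamma>) x"
    using \<open>N \<ge> 2\<close> x w by (intro rpow_sum_ge) auto
  ultimately show ?thesis
    by (simp add: pow p q flip: x_def)
qed

end
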